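(* Let $G$ and $H$ be oriented graphs that are orthogonal and homomorphically incomparable (i.e. there is no homomorphism $G\to H$ and no homomorphism $H\to G$). Then the tensor product of their cones, $G^{\triangleleft}\times H^{\triangleleft}$, is a core.
   Context: All digraphs are finite, without loops and without parallel arcs; a pair of opposite arcs $u\to v$, $v\to u$ (a digon) is allowed in a digraph. An oriented graph is a digraph with no digon. A homomorphism $G\to H$ is a map $V(G)\to V(H)$ sending arcs to arcs (preserving direction). The tensor product $G\times H$ has vertex set $V(G)\times V(H)$, with an arc from $(u_1,v_1)$ to $(u_2,v_2)$ iff $u_1\to u_2$ is an arc of $G$ and $v_1\to v_2$ is an arc of $H$. A retract of $G$ is an endomorphism $\phi:G\to G$ with $\phi^2=\phi$; $G$ is a core if its only retract is the identity (equivalently, it is not homomorphically equivalent to any digraph with fewer vertices). $G$ and $H$ are orthogonal if every homomorphism $G\times H\to G$ is surjective on vertices and every homomorphism $G\times H\to H$ is surjective on vertices. The cone $G^{\triangleleft}$ of a digraph $G$ is obtained from $G$ by adding one new vertex $\star_G$ (the apex), joined by arcs in both directions to every vertex of $G$. *)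

theory Defs
  imports "Graph_Theory.Pair_Digraph"
begin

text \<open>
  Finite digraphs without loops and without parallel arcs are those of the locale
  \<^locale>\<open>pair_digraph\<close>; digons are allowed there.
\<close>

locale oriented_graph = pair_digraph +
  assumes no_digon: "(u, v) \<in> parcs G \<Longrightarrow> (v, u) \<notin> parcs G"

text \<open>
  A homomorphism is a total HOL function of which only the values on the vertex set matter.
  Accordingly, equations between homomorphisms are stated pointwise on the vertex set.
\<close>

definition digraph_hom ::
  "'a pair_pre_digraph \<Rightarrow> 'b pair_pre_digraph \<Rightarrow> ('a \<Rightarrow> 'b) set" where
  "digraph_hom G H =
    {f. f \<in> pverts G \<rightarrow> pverts H \<and> (\<forall>(u, v) \<in> parcs G. (f u, f v) \<in> parcs H)}"

definition tensor_product ::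
  "'a pair_pre_digraph \<Rightarrow> 'b pair_pre_digraph \<Rightarrow> ('a \<times> 'b) pair_pre_digraph" where
  "tensor_product G H =
    \<lparr> pverts = pverts G \<times> pverts H,
      parcs = {((u1, v1), (u2, v2)) | u1 v1 u2 v2. (u1, u2) \<in> parcs G \<and> (v1, v2) \<in> parcs H} \<rparr>"

text \<open>The apex of the cone is \<^const>\<open>None\<close>; a vertex \<open>v\<close> of the base is \<open>Some v\<close>.\<close>

definition cone :: "'a pair_pre_digraph \<Rightarrow> 'a option pair_pre_digraph" where
  "cone G =
    \<lparr> pverts = insert None (Some ` pverts G),
      parcs = {(Some u, Some v) | u v. (u, v) \<in> parcs G}
        \<union> {(None, Some v) | v. v \<in> pverts G}
        \<union> {(Some v, None) | v. v \<in> pverts G} \<rparr>"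

definition retract :: "'a pair_pre_digraph \<Rightarrow> ('a \<Rightarrow> 'a) \<Rightarrow> bool" where
  "retract G \<phi> \<longleftrightarrow> \<phi> \<in> digraph_hom G G \<and> (\<forall>v \<in> pverts G. \<phi> (\<phi> v) = \<phi> v)"

definition is_core :: "'a pair_pre_digraph \<Rightarrow> bool" where
  "is_core G \<longleftrightarrow> (\<forall>\<phi>. retract G \<phi> \<longrightarrow> (\<forall>v \<in> pverts G. \<phi> v = v))"

definition orthogonal_digraphs ::
  "'a pair_pre_digraph \<Rightarrow> 'b pair_pre_digraph \<Rightarrow> bool" where
  "orthogonal_digraphs G H \<longleftrightarrow>
    (\<forall>f \<in> digraph_hom (tensor_product G H) G. f ` pverts (tensor_product G H) = pverts G) \<and>
    (\<forall>f \<in> digraph_hom (tensor_product G H) H. f ` pverts (tensor_product G H) = pverts H)"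

definition hom_incomparable ::
  "'a pair_pre_digraph \<Rightarrow> 'b pair_pre_digraph \<Rightarrow> bool" where
  "hom_incomparable G H \<longleftrightarrow> digraph_hom G H = {} \<and> digraph_hom H G = {}"

lemma pair_digraph_tensor_product:
  assumes "pair_digraph G" and "pair_digraph H"
  shows "pair_digraph (tensor_product G H)"
proof -
  interpret G: pair_digraph G by fact
  interpret H: pair_digraph H by fact
  have sub: "parcs (tensor_product G H) \<subseteq>
      pverts (tensor_product G H) \<times> pverts (tensor_product G H)"
    by (auto simp: tensor_product_def dest: G.in_arcsD1 G.in_arcsD2 H.in_arcsD1 H.in_arcsD2)
  have fin: "finite (pverts (tensor_product G H))"
    by (simp add: tensor_product_def G.pair_finite_verts H.pair_finite_verts)
  show ?thesis
  proof
    show "finite (parcs (tensor_product G H))"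
      using sub fin by (meson finite_SigmaI finite_subset)
  next
    fix e assume "e \<in> parcs (tensor_product G H)"
    then show "fst e \<noteq> snd e"
      by (auto simp: tensor_product_def dest: G.no_loops')
  qed (use sub fin in auto)
qed

lemma pair_digraph_cone:
  assumes "pair_digraph G"
  shows "pair_digraph (cone G)"
proof -
  interpret G: pair_digraph G by fact
  have sub: "parcs (cone G) \<subseteq> pverts (cone G) \<times> pverts (cone G)"
    by (auto simp: cone_def dest: G.in_arcsD1 G.in_arcsD2)
  have fin: "finite (pverts (cone G))"
    by (simp add: cone_def G.pair_finite_verts)
  show ?thesis
  proof
    show "finite (parcs (cone G))"
      using sub fin by (meson finite_SigmaI finite_subset)
  next
    fix e assume "e \<in> parcs (cone G)"
    then show "fst e \<noteq> snd e"
      by (auto simp: cone_def dest: G.no_loops')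
  qed (use sub fin in auto)
qed

end

theory Submission
  imports Defs
begin

text \<open>
  In the product of the two cones every digon joins two vertices exactly one of which has an
  apex as first coordinate, and likewise for the second coordinate. A retraction \<open>\<phi>\<close> preserves
  digons, hence fixes the pair of apexes, maps \<open>G \<times> H\<close> into itself, and treats the vertices
  \<open>(g, \<star>)\<close> uniformly. If they were all sent to the pair of apexes, \<open>\<phi>\<close> would induce a
  homomorphism from \<open>G\<^sup>\<triangleleft> \<times> H\<close> to \<open>G\<close>; iterating it fibrewise over \<open>H\<close> until
  the powers become periodic turns the fibre over the apex into a homomorphism \<open>H \<rightarrow> G\<close>, which
  does not exist. If \<open>\<phi>\<close> maps \<open>(g, \<star>)\<close> to \<open>(p g, \<star>)\<close>, the same iteration
  together with orthogonality makes \<open>p\<close> a homomorphism of the core \<open>G\<close>, so \<open>p\<close> is the identity;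
  then \<open>g\<close> and the first coordinate of \<open>\<phi> (g, h)\<close> have nested neighbourhoods in \<open>G\<close>, so they
  coincide.
\<close>

section \<open>Iteration of finite families of self-maps\<close>

text \<open>Pigeonhole on whole families: restricted to \<open>B \<times> A\<close>, the powers live
  in a finite function space. One pair \<open>i\<close>, \<open>n\<close> therefore serves all
  \<open>h\<close> at once, as is needed to compare different fibres.\<close>

lemma finite_family_funpow_periodic:
  assumes "finite A" "finite B" and f: "\<And>h. h \<in> B \<Longrightarrow> f h \<in> A \<rightarrow> A"
  obtains i n where "0 < n" "\<And>h x. h \<in> B \<Longrightarrow> x \<in> A \<Longrightarrow> (f h ^^ (i + n)) x = (f h ^^ i) x"
proof -
  define F where "F n = restrict (\<lambda>(h, x). (f h ^^ n) x) (B \<times> A)" for n :: nat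
  have pow: "(f h ^^ n) x \<in> A" if "h \<in> B" "x \<in> A" for h x n
    using f that by (induction n) auto
  then have "range F \<subseteq> (B \<times> A) \<rightarrow>\<^sub>E A"
    unfolding F_def by (intro image_subsetI) (simp add: restrict_PiE_iff split_beta mem_Times_iff)
  moreover have "finite ((B \<times> A) \<rightarrow>\<^sub>E A)"
    using assms by (intro finite_PiE) auto
  ultimately have "\<not> inj F"
    using finite_subset range_inj_infinite by blast
  then obtain i j where "i < j" "F i = F j"
    by (metis injI linorder_neqE_nat)
  then have "(f h ^^ (i + (j - i))) x = (f h ^^ i) x" if "h \<in> B" "x \<in> A" for h x
  proof -
    have "F i (h, x) = F j (h, x)"
      using \<open>F i = F j\<close> by simp
    with that \<open>i < j\<close> show ?thesis
      by (simp add: F_def)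
  qed
  with \<open>i < j\<close> show thesis
    by (intro that[of "j - i" i]) auto
qed

text \<open>Here \<open>f\<close> and \<open>c\<close> are the base part and the apex fibre of a map
  from the product of \<open>cone A\<close> and \<open>B\<close> to \<open>A\<close>. Pushing an arc
  from \<open>fc\<close> forward by \<open>f\<close> keeps its source one application ahead of its
  target; periodicity removes this lead.\<close>

lemma digraph_hom_of_apex_fiber:
  fixes A :: "'a pair_pre_digraph" and B :: "'b pair_pre_digraph"
  assumes "pair_digraph A" "pair_digraph B"
    and f: "\<And>h g. h \<in> pverts B \<Longrightarrow> g \<in> pverts A \<Longrightarrow> f h g \<in> pverts A"
    and c: "\<And>h. h \<in> pverts B \<Longrightarrow> c h \<in> pverts A"
    and ff: "\<And>g g' h h'. (g, g') \<in> parcs A \<Longrightarrow> (h, h') \<in> parcs B \<Longrightarrow> (f h g, f h' g') \<in> parcs A"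
    and fc: "\<And>g h h'. g \<in> pverts A \<Longrightarrow> (h, h') \<in> parcs B \<Longrightarrow> (f h g, c h') \<in> parcs A"
  shows "digraph_hom B A \<noteq> {}"
proof -
  interpret A: pair_digraph A by fact
  interpret B: pair_digraph B by fact
  obtain i n where "0 < n"
    and per: "\<And>h x. h \<in> pverts B \<Longrightarrow> x \<in> pverts A \<Longrightarrow> (f h ^^ (i + n)) x = (f h ^^ i) x"
    by (rule finite_family_funpow_periodic[of "pverts A" "pverts B" f]) (use f in auto)
  have pow: "(f h ^^ k) x \<in> pverts A" if "h \<in> pverts B" "x \<in> pverts A" for h x k
    using f that by (induction k) auto
  have arc: "(f h (f h ((f h ^^ k) x)), f h' ((f h' ^^ k) (c h'))) \<in> parcs A"
    if "(f h ((f h ^^ k) x), (f h' ^^ k) (c h')) \<in> parcs A" "(h, h') \<in> parcs B" for h h' k x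
    using ff that by blast
  have step: "((f h ^^ Suc k) x, (f h' ^^ k) (c h')) \<in> parcs A"
    if "(h, h') \<in> parcs B" "x \<in> pverts A" for h h' k x
    using that by (induction k) (auto intro: fc arc)
  have "((f h ^^ i) (c h), (f h' ^^ i) (c h')) \<in> parcs A" if "(h, h') \<in> parcs B" for h h'
  proof -
    have h: "h \<in> pverts B"
      using that B.in_arcsD1 by blast
    \<comment> \<open>The free point \<open>x\<close> of \<open>step\<close> is chosen as the
      \<open>(n - 1)\<close>-st iterate of \<open>c h\<close>, so that the extra application
      completes a full period.\<close>
    have "Suc i + (n - 1) = i + n"
      using \<open>0 < n\<close> by simp
    then have "(f h ^^ Suc i) ((f h ^^ (n - 1)) (c h)) = (f h ^^ (i + n)) (c h)"
      by (metis comp_apply funpow_add)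
    then show ?thesis
      using step[OF that pow[OF h c[OF h]], of i "n - 1"] per[OF h c[OF h]] by simp
  qed
  then have "(\<lambda>h. (f h ^^ i) (c h)) \<in> digraph_hom B A"
    by (auto simp: digraph_hom_def pow c)
  then show ?thesis by blast
qed

section \<open>Consequences of orthogonality and incomparability\<close>

text \<open>Half of orthogonality, curried so that it applies to either factor.\<close>

definition factor_homs_onto :: "'a pair_pre_digraph \<Rightarrow> 'b pair_pre_digraph \<Rightarrow> bool" where
  "factor_homs_onto A B \<longleftrightarrow> (\<forall>f.
    (\<forall>h \<in> pverts B. \<forall>g \<in> pverts A. f h g \<in> pverts A) \<longrightarrow>
    (\<forall>g g' h h'. (g, g') \<in> parcs A \<longrightarrow> (h, h') \<in> parcs B \<longrightarrow> (f h g, f h' g') \<in> parcs A) \<longrightarrow>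
    (\<forall>y \<in> pverts A. \<exists>h \<in> pverts B. \<exists>g \<in> pverts A. f h g = y))"

lemma factor_homs_ontoE:
  assumes "factor_homs_onto A B"
    and "\<And>h g. h \<in> pverts B \<Longrightarrow> g \<in> pverts A \<Longrightarrow> f h g \<in> pverts A"
    and "\<And>g g' h h'. (g, g') \<in> parcs A \<Longrightarrow> (h, h') \<in> parcs B \<Longrightarrow> (f h g, f h' g') \<in> parcs A"
    and "y \<in> pverts A"
  obtains h g where "h \<in> pverts B" "g \<in> pverts A" "f h g = y"
  using assms unfolding factor_homs_onto_def by metis

lemma orthogonal_digraphs_factor_homs_onto:
  assumes "orthogonal_digraphs G H"
  shows "factor_homs_onto G H" "factor_homs_onto H G"
proof -
  show "factor_homs_onto G H"
    unfolding factor_homs_onto_def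
  proof (intro allI impI ballI)
    fix f y
    assume f: "\<forall>h \<in> pverts H. \<forall>g \<in> pverts G. f h g \<in> pverts G"
      "\<forall>g g' h h'. (g, g') \<in> parcs G \<longrightarrow> (h, h') \<in> parcs H \<longrightarrow> (f h g, f h' g') \<in> parcs G"
      and y: "y \<in> pverts G"
    then have "(\<lambda>(g, h). f h g) \<in> digraph_hom (tensor_product G H) G"
      by (auto simp: digraph_hom_def tensor_product_def)
    then have "(\<lambda>(g, h). f h g) ` pverts (tensor_product G H) = pverts G"
      using assms by (auto simp: orthogonal_digraphs_def)
    then show "\<exists>h \<in> pverts H. \<exists>g \<in> pverts G. f h g = y"
      using y by (force simp: tensor_product_def)
  qed
  show "factor_homs_onto H G"
    unfolding factor_homs_onto_def
  proof (intro allI impI ballI)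
    fix f y
    assume f: "\<forall>h \<in> pverts G. \<forall>g \<in> pverts H. f h g \<in> pverts H"
      "\<forall>g g' h h'. (g, g') \<in> parcs H \<longrightarrow> (h, h') \<in> parcs G \<longrightarrow> (f h g, f h' g') \<in> parcs H"
      and y: "y \<in> pverts H"
    then have "(\<lambda>(g, h). f g h) \<in> digraph_hom (tensor_product G H) H"
      by (auto simp: digraph_hom_def tensor_product_def)
    then have "(\<lambda>(g, h). f g h) ` pverts (tensor_product G H) = pverts H"
      using assms by (auto simp: orthogonal_digraphs_def)
    then show "\<exists>h \<in> pverts G. \<exists>g \<in> pverts H. f h g = y"
      using y by (force simp: tensor_product_def)
  qed
qed

text \<open>Here \<open>p\<close> is the fibre of the map over the apex of \<open>cone B\<close>. By
  surjectivity every vertex is fixed by \<open>f h ^^ n\<close> for a suitable \<open>h\<close>;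
  such an \<open>h\<close> can be chosen separately for each end of an arc, which turns the mixed
  arcs of \<open>fp\<close> and \<open>pf\<close> into arcs between values of
  \<open>p\<close>.\<close>

lemma apex_fiber_eq_identity:
  fixes A :: "'a pair_pre_digraph" and B :: "'b pair_pre_digraph"
  assumes "pair_digraph A" "pair_digraph B" and onto: "factor_homs_onto A B"
    and f: "\<And>h g. h \<in> pverts B \<Longrightarrow> g \<in> pverts A \<Longrightarrow> f h g \<in> pverts A"
    and p: "\<And>g. g \<in> pverts A \<Longrightarrow> p g \<in> pverts A"
    and idem: "\<And>g. g \<in> pverts A \<Longrightarrow> p (p g) = p g"
    and ff: "\<And>g g' h h'. (g, g') \<in> parcs A \<Longrightarrow> (h, h') \<in> parcs B \<Longrightarrow> (f h g, f h' g') \<in> parcs A"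
    and fp: "\<And>g g' h. (g, g') \<in> parcs A \<Longrightarrow> h \<in> pverts B \<Longrightarrow> (f h g, p g') \<in> parcs A"
    and pf: "\<And>g g' h. (g, g') \<in> parcs A \<Longrightarrow> h \<in> pverts B \<Longrightarrow> (p g, f h g') \<in> parcs A"
    and x: "x \<in> pverts A"
  shows "p x = x"
proof -
  interpret A: pair_digraph A by fact
  interpret B: pair_digraph B by fact
  obtain i n where "0 < n"
    and per: "\<And>h x. h \<in> pverts B \<Longrightarrow> x \<in> pverts A \<Longrightarrow> (f h ^^ (i + n)) x = (f h ^^ i) x"
    by (rule finite_family_funpow_periodic[of "pverts A" "pverts B" f]) (use f in auto)
  have pow: "(f h ^^ k) x \<in> pverts A" if "h \<in> pverts B" "x \<in> pverts A" for h x k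
    using f that by (induction k) auto
  have ffk: "((f h ^^ k) g, (f h' ^^ k) g') \<in> parcs A"
    if "(g, g') \<in> parcs A" "(h, h') \<in> parcs B" for g g' h h' k
    using that by (induction k) (auto intro: ff)
  have fpk: "((f h ^^ k) g, (p ^^ k) g') \<in> parcs A"
    if "(g, g') \<in> parcs A" "h \<in> pverts B" for g g' h k
    using that by (induction k) (auto intro: fp)
  have pfk: "((p ^^ k) g, (f h ^^ k) g') \<in> parcs A"
    if "(g, g') \<in> parcs A" "h \<in> pverts B" for g g' h k
    using that by (induction k) (auto intro: pf)
  have "(p ^^ Suc k) g = p g" if "g \<in> pverts A" for g k
    using that by (induction k) (auto simp: idem)
  with \<open>0 < n\<close> have pn: "(p ^^ n) g = p g" if "g \<in> pverts A" for g
    using that by (metis Suc_pred)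
  \<comment> \<open>The \<open>i\<close>-th powers again form a homomorphism on the product, hence
    are onto, and whatever they reach is already periodic.\<close>
  have returns: "\<exists>h \<in> pverts B. (f h ^^ n) z = z" if z: "z \<in> pverts A" for z
  proof -
    obtain h g where hg: "h \<in> pverts B" "g \<in> pverts A" "(f h ^^ i) g = z"
      by (rule factor_homs_ontoE[OF onto, of "\<lambda>h. f h ^^ i" z])
        (use pow ffk z in blast)+
    then have "(f h ^^ n) z = (f h ^^ (n + i)) g"
      by (auto simp: funpow_add)
    also have "\<dots> = z"
      using per[of h g] hg by (simp add: add.commute)
    finally show ?thesis
      using hg by blast
  qed
  have hom: "(p g, p g') \<in> parcs A" if arc: "(g, g') \<in> parcs A" for g g'
  proof -
    have g: "g \<in> pverts A" "g' \<in> pverts A"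
      using arc A.in_arcsD1 A.in_arcsD2 by blast+
    obtain h where "h \<in> pverts B" "(f h ^^ n) g = g"
      using returns g by blast
    then have gp: "(g, p g') \<in> parcs A"
      using fpk[OF arc, of h n] pn g by simp
    obtain h' where "h' \<in> pverts B" "(f h' ^^ n) (p g') = p g'"
      using returns p g by blast
    then show ?thesis
      using pfk[OF gp, of h' n] pn g by simp
  qed
  \<comment> \<open>Being a homomorphism, \<open>p\<close> counts as a family constant in
    \<open>h\<close> and is onto; an idempotent map fixes its image.\<close>
  obtain h g where "g \<in> pverts A" "p g = x"
    by (rule factor_homs_ontoE[OF onto, of "\<lambda>_. p" x]) (use p hom x in blast)+
  then show ?thesis
    using idem by blast
qed

text \<open>Folding \<open>x\<close> onto \<open>x'\<close> and fixing all other vertices is an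
  endomorphism; if \<open>x'\<close> differed from \<open>x\<close>, it would miss
  \<open>x\<close>.\<close>

lemma dominating_vertex_eq:
  assumes "pair_digraph A" and onto: "factor_homs_onto A B"
    and "x \<in> pverts A" "x' \<in> pverts A"
    and out: "\<And>y. (x, y) \<in> parcs A \<Longrightarrow> (x', y) \<in> parcs A"
    and inn: "\<And>y. (y, x) \<in> parcs A \<Longrightarrow> (y, x') \<in> parcs A"
  shows "x' = x"
proof -
  interpret A: pair_digraph A by fact
  \<comment> \<open>Without loops an arc has at most one end at \<open>x\<close>, so
    \<open>out\<close> or \<open>inn\<close> alone handles it.\<close>
  have "(x, x) \<notin> parcs A"
    using A.no_loops' by blast
  then have hom: "((if g = x then x' else g), (if g' = x then x' else g')) \<in> parcs A"
    if "(g, g') \<in> parcs A" for g g'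
    using that out inn by auto
  obtain g where "(if g = x then x' else g) = x"
    by (rule factor_homs_ontoE[OF onto, of "\<lambda>_ g. if g = x then x' else g" x])
      (use hom assms in auto)
  then show ?thesis
    by (auto split: if_splits)
qed

text \<open>An arcless digraph maps to any single vertex, and a digraph without vertices maps
  anywhere.\<close>

lemma parcs_nonempty_of_no_hom:
  assumes "pair_digraph A" "pair_digraph B" "digraph_hom A B = {}" "digraph_hom B A = {}"
  shows "parcs A \<noteq> {}"
proof
  assume "parcs A = {}"
  interpret B: pair_digraph B by fact
  have "pverts B \<noteq> {}"
  proof
    assume "pverts B = {}"
    moreover from this have "parcs B = {}"
      using B.in_arcsD1 by fastforce
    ultimately have "(\<lambda>_. undefined) \<in> digraph_hom B A"
      by (auto simp: digraph_hom_def)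
    with assms show False by blast
  qed
  then obtain b where "b \<in> pverts B" by blast
  with \<open>parcs A = {}\<close> have "(\<lambda>_. b) \<in> digraph_hom A B"
    by (auto simp: digraph_hom_def)
  with assms show False by blast
qed

section \<open>Arcs and digons of cones and of their product\<close>

lemma parcs_cone_iff [simp]:
  "(Some u, Some v) \<in> parcs (cone G) \<longleftrightarrow> (u, v) \<in> parcs G"
  "(None, Some v) \<in> parcs (cone G) \<longleftrightarrow> v \<in> pverts G"
  "(Some v, None) \<in> parcs (cone G) \<longleftrightarrow> v \<in> pverts G"
  "(None, None) \<notin> parcs (cone G)"
  by (auto simp: cone_def)

lemma pverts_cone_iff [simp]:
  "None \<in> pverts (cone G)"
  "Some v \<in> pverts (cone G) \<longleftrightarrow> v \<in> pverts G"
  by (auto simp: cone_def)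

lemma parcs_tensor_product_iff:
  "(u, v) \<in> parcs (tensor_product G H) \<longleftrightarrow>
    (fst u, fst v) \<in> parcs G \<and> (snd u, snd v) \<in> parcs H"
  by (cases u; cases v) (auto simp: tensor_product_def)

lemma pverts_tensor_product_iff:
  "u \<in> pverts (tensor_product G H) \<longleftrightarrow> fst u \<in> pverts G \<and> snd u \<in> pverts H"
  by (cases u) (auto simp: tensor_product_def)

lemma (in oriented_graph) cone_digon_apex:
  assumes "(x, y) \<in> parcs (cone G)" "(y, x) \<in> parcs (cone G)"
  shows "x = None \<longleftrightarrow> y \<noteq> None"
  using assms no_digon by (cases x; cases y) auto

theorem theorem36:
  fixes G :: "'a pair_pre_digraph" and H :: "'b pair_pre_digraph"
  assumes "oriented_graph G" and "oriented_graph H"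
    and "orthogonal_digraphs G H"
    and "hom_incomparable G H"
  shows "is_core (tensor_product (cone G) (cone H))"
  unfolding is_core_def
proof (intro allI impI)
  interpret G: oriented_graph G by fact
  interpret H: oriented_graph H by fact
  let ?P = "tensor_product (cone G) (cone H)"
  note ontoG = orthogonal_digraphs_factor_homs_onto(1)[OF assms(3)]
  note ontoH = orthogonal_digraphs_factor_homs_onto(2)[OF assms(3)]
  have pdG: "pair_digraph G" and pdH: "pair_digraph H"
    by unfold_locales
  have noGH: "digraph_hom G H = {}" and noHG: "digraph_hom H G = {}"
    using assms(4) by (auto simp: hom_incomparable_def)
  obtain g0 g1 where g01: "(g0, g1) \<in> parcs G"
    using parcs_nonempty_of_no_hom[OF pdG pdH noGH noHG] by (metis ex_in_conv surj_pair)
  obtain h0 h1 where h01: "(h0, h1) \<in> parcs H"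
    using parcs_nonempty_of_no_hom[OF pdH pdG noHG noGH] by (metis ex_in_conv surj_pair)
  have g0: "g0 \<in> pverts G" "g1 \<in> pverts G" and h0: "h0 \<in> pverts H" "h1 \<in> pverts H"
    using g01 h01 G.in_arcsD1 G.in_arcsD2 H.in_arcsD1 H.in_arcsD2 by blast+

  fix \<phi> assume "retract ?P \<phi>"
  then have "\<phi> \<in> digraph_hom ?P ?P" and idem: "\<And>v. v \<in> pverts ?P \<Longrightarrow> \<phi> (\<phi> v) = \<phi> v"
    by (auto simp: retract_def)
  then have vert: "\<phi> v \<in> pverts ?P" if "v \<in> pverts ?P" for v
    using that by (auto simp: digraph_hom_def)
  from \<open>\<phi> \<in> digraph_hom ?P ?P\<close>
  have arc: "(\<phi> u, \<phi> v) \<in> parcs ?P" if "(u, v) \<in> parcs ?P" for u v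
    using that by (auto simp: digraph_hom_def)
  define a where "a x y = fst (\<phi> (x, y))" for x y
  define b where "b x y = snd (\<phi> (x, y))" for x y
  have \<phi>: "\<phi> (x, y) = (a x y, b x y)" for x y
    by (simp add: a_def b_def)
  have va: "a x y \<in> pverts (cone G)" and vb: "b x y \<in> pverts (cone H)"
    if "x \<in> pverts (cone G)" "y \<in> pverts (cone H)" for x y
    using vert[of "(x, y)"] that by (auto simp: pverts_tensor_product_iff \<phi>)
  have arca: "(a x y, a x' y') \<in> parcs (cone G)" and arcb: "(b x y, b x' y') \<in> parcs (cone H)"
    if "(x, x') \<in> parcs (cone G)" "(y, y') \<in> parcs (cone H)" for x x' y y'
    using arc[of "(x, y)" "(x', y')"] that by (auto simp: parcs_tensor_product_iff \<phi>)
  have digon: "a x y = None \<longleftrightarrow> a x' y' \<noteq> None" "b x y = None \<longleftrightarrow> b x' y' \<noteq> None"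
    if "(x, x') \<in> parcs (cone G)" "(x', x) \<in> parcs (cone G)"
      "(y, y') \<in> parcs (cone H)" "(y', y) \<in> parcs (cone H)" for x x' y y'
    using G.cone_digon_apex[OF arca[OF that(1,3)] arca[OF that(2,4)]]
      H.cone_digon_apex[OF arcb[OF that(1,3)] arcb[OF that(2,4)]] by blast+
  \<comment> \<open>Two kinds of digons are exploited: those from the pair of apexes to the base
    vertices, and in \<open>side\<close> those between the two kinds of vertices with exactly one
    apex coordinate.\<close>
  have leaf: "a (Some g) (Some h) = None \<longleftrightarrow> a None None \<noteq> None"
      "b (Some g) (Some h) = None \<longleftrightarrow> b None None \<noteq> None"
    if "g \<in> pverts G" "h \<in> pverts H" for g h
    by (rule digon; use that in simp)+
  have side: "a (Some g) None = None \<longleftrightarrow> a None (Some h) \<noteq> None"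
      "b (Some g) None = None \<longleftrightarrow> b None (Some h) \<noteq> None"
    if "g \<in> pverts G" "h \<in> pverts H" for g h
    by (rule digon; use that in simp)+

  \<comment> \<open>Otherwise all of \<open>G \<times> H\<close>, arcs included, would be sent to an apex in some coordinate.\<close>
  have apexes: "a None None = None" "b None None = None"
  proof -
    have "(a (Some g0) (Some h0), a (Some g1) (Some h1)) \<in> parcs (cone G)"
      "(b (Some g0) (Some h0), b (Some g1) (Some h1)) \<in> parcs (cone H)"
      using arca arcb g01 h01 by simp_all
    then show "a None None = None" "b None None = None"
      using leaf[OF g0(1) h0(1)] leaf[OF g0(2) h0(2)] by (metis parcs_cone_iff(4))+
  qed

  define f where "f h g = the (a (Some g) (Some h))" for h g
  define k where "k g h = the (b (Some g) (Some h))" for g h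
  have af: "a (Some g) (Some h) = Some (f h g)" and bk: "b (Some g) (Some h) = Some (k g h)"
    if "g \<in> pverts G" "h \<in> pverts H" for g h
    using leaf[OF that] apexes by (auto simp: f_def k_def)
  have vf: "f h g \<in> pverts G" and vk: "k g h \<in> pverts H"
    if "g \<in> pverts G" "h \<in> pverts H" for g h
    using va[of "Some g" "Some h"] vb[of "Some g" "Some h"] that by (simp_all add: af bk)
  have ff: "(f h g, f h' g') \<in> parcs G" and kk: "(k g h, k g' h') \<in> parcs H"
    if "(g, g') \<in> parcs G" "(h, h') \<in> parcs H" for g g' h h'
    using arca[of "Some g" "Some g'" "Some h" "Some h'"]
      arcb[of "Some g" "Some g'" "Some h" "Some h'"] that
    by (simp_all add: af bk G.in_arcsD1 G.in_arcsD2 H.in_arcsD1 H.in_arcsD2)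

  \<comment> \<open>Four cases, by which coordinates of the image of \<open>(Some g0, None)\<close>
    are apexes; three are refuted. In this one, \<open>side\<close> sends the apex fibre over
    \<open>H\<close> into \<open>G\<close>.\<close>
  have "\<not> (a (Some g0) None = None \<and> b (Some g0) None = None)"
  proof
    assume *: "a (Some g0) None = None \<and> b (Some g0) None = None"
    define c where "c h = the (a None (Some h))" for h
    have ac: "a None (Some h) = Some (c h)" if "h \<in> pverts H" for h
      using side[OF g0(1) that] * by (auto simp: c_def)
    have vc: "c h \<in> pverts G" if "h \<in> pverts H" for h
      using va[of None "Some h"] that by (simp add: ac)
    have fc: "(f h g, c h') \<in> parcs G" if "g \<in> pverts G" "(h, h') \<in> parcs H" for g h h'
      using arca[of "Some g" None "Some h" "Some h'"] that
      by (simp add: af ac H.in_arcsD1 H.in_arcsD2)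
    have "digraph_hom H G \<noteq> {}"
      by (rule digraph_hom_of_apex_fiber[of G H f c]) (use pdG pdH vf vc ff fc in blast)+
    with noHG show False by blast
  qed
  moreover have "\<not> (a (Some g0) None \<noteq> None \<and> b (Some g0) None \<noteq> None)"
  proof
    assume *: "a (Some g0) None \<noteq> None \<and> b (Some g0) None \<noteq> None"
    define c where "c g = the (b (Some g) None)" for g
    have bc: "b (Some g) None = Some (c g)" if "g \<in> pverts G" for g
      \<comment> \<open>The common partner \<open>(None, Some h0)\<close> transfers the case
        assumption from \<open>g0\<close> to every \<open>g\<close>.\<close>
      using side[OF g0(1) h0(1)] side[OF that h0(1)] * by (auto simp: c_def)
    have vc: "c g \<in> pverts H" if "g \<in> pverts G" for g
      using vb[of "Some g" None] that by (simp add: bc)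
    have kc: "(k g h, c g') \<in> parcs H" if "h \<in> pverts H" "(g, g') \<in> parcs G" for g g' h
      using arcb[of "Some g" "Some g'" "Some h" None] that
      by (simp add: bk bc G.in_arcsD1 G.in_arcsD2)
    have "digraph_hom G H \<noteq> {}"
      by (rule digraph_hom_of_apex_fiber[of H G k c]) (use pdG pdH vk vc kk kc in blast)+
    with noGH show False by blast
  qed
  moreover have "\<not> (a (Some g0) None = None \<and> b (Some g0) None \<noteq> None)"
  proof
    assume *: "a (Some g0) None = None \<and> b (Some g0) None \<noteq> None"
    then obtain h where h: "b (Some g0) None = Some h" by blast
    then have "h \<in> pverts H"
      using vb[of "Some g0" None] g0 by simp
    then have "a None (Some h) \<noteq> None"
      using side g0 * by blast
    \<comment> \<open>Idempotence would make \<open>(None, Some h)\<close> a fixed point, whereas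
      \<open>side\<close> forbids an apex as first coordinate of its image.\<close>
    then show False
      using idem[of "(Some g0, None)"] g0 * h by (simp add: pverts_tensor_product_iff \<phi>)
  qed
  ultimately have "a (Some g0) None \<noteq> None \<and> b (Some g0) None = None"
    by argo
  then have sideG: "a (Some g) None \<noteq> None" "b (Some g) None = None" if "g \<in> pverts G" for g
    using side[OF g0(1) h0(1)] side[OF that h0(1)] by simp_all
  then have sideH: "a None (Some h) = None" "b None (Some h) \<noteq> None" if "h \<in> pverts H" for h
    using side[OF g0(1) that] sideG[OF g0(1)] by simp_all

  define p where "p g = the (a (Some g) None)" for g
  define q where "q h = the (b None (Some h))" for h
  have ap: "a (Some g) None = Some (p g)" if "g \<in> pverts G" for g
    using sideG[OF that] by (auto simp: p_def)
  have bq: "b None (Some h) = Some (q h)" if "h \<in> pverts H" for h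
    using sideH[OF that] by (auto simp: q_def)
  have vp: "p g \<in> pverts G" if "g \<in> pverts G" for g
    using va[of "Some g" None] that by (simp add: ap)
  have vq: "q h \<in> pverts H" if "h \<in> pverts H" for h
    using vb[of None "Some h"] that by (simp add: bq)
  have pp: "p (p g) = p g" if "g \<in> pverts G" for g
    using idem[of "(Some g, None)"] that
    by (simp add: pverts_tensor_product_iff \<phi> ap sideG vp)
  have qq: "q (q h) = q h" if "h \<in> pverts H" for h
    using idem[of "(None, Some h)"] that
    by (simp add: pverts_tensor_product_iff \<phi> bq sideH vq)
  have fp: "(f h g, p g') \<in> parcs G" and pf: "(p g, f h g') \<in> parcs G"
    if "(g, g') \<in> parcs G" "h \<in> pverts H" for g g' h
    using arca[of "Some g" "Some g'" "Some h" None] arca[of "Some g" "Some g'" None "Some h"] that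
    by (simp_all add: af ap G.in_arcsD1 G.in_arcsD2)
  have kq: "(k g h, q h') \<in> parcs H" and qk: "(q h, k g h') \<in> parcs H"
    if "(h, h') \<in> parcs H" "g \<in> pverts G" for g h h'
    using arcb[of "Some g" None "Some h" "Some h'"] arcb[of None "Some g" "Some h" "Some h'"] that
    by (simp_all add: bk bq H.in_arcsD1 H.in_arcsD2)
  have p_id: "p g = g" if "g \<in> pverts G" for g
    by (rule apex_fiber_eq_identity[of G H f p])
      (use pdG pdH ontoG vf vp pp ff fp pf that in blast)+
  have q_id: "q h = h" if "h \<in> pverts H" for h
    by (rule apex_fiber_eq_identity[of H G k q])
      (use pdG pdH ontoH vk vq qq kk kq qk that in blast)+
  \<comment> \<open>With \<open>p\<close> the identity, \<open>fp\<close> and \<open>pf\<close> say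
    that every neighbour of \<open>g\<close> is a neighbour of \<open>f h g\<close> in the same
    direction.\<close>
  have f_id: "f h g = g" if "g \<in> pverts G" "h \<in> pverts H" for g h
  proof (rule dominating_vertex_eq[OF pdG ontoG])
    show "(f h g, y) \<in> parcs G" if "(g, y) \<in> parcs G" for y
      using fp[OF that \<open>h \<in> pverts H\<close>] p_id that G.in_arcsD2 by metis
    show "(y, f h g) \<in> parcs G" if "(y, g) \<in> parcs G" for y
      using pf[OF that \<open>h \<in> pverts H\<close>] p_id that G.in_arcsD1 by metis
  qed (use that vf in auto)
  have k_id: "k g h = h" if "g \<in> pverts G" "h \<in> pverts H" for g h
  proof (rule dominating_vertex_eq[OF pdH ontoH])
    show "(k g h, y) \<in> parcs H" if "(h, y) \<in> parcs H" for y
      using kq[OF that \<open>g \<in> pverts G\<close>] q_id that H.in_arcsD2 by metis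
    show "(y, k g h) \<in> parcs H" if "(y, h) \<in> parcs H" for y
      using qk[OF that \<open>g \<in> pverts G\<close>] q_id that H.in_arcsD1 by metis
  qed (use that vk in auto)

  show "\<forall>v \<in> pverts ?P. \<phi> v = v"
  proof
    fix v assume v: "v \<in> pverts ?P"
    obtain x y where xy: "v = (x, y)" by fastforce
    show "\<phi> v = v"
      using v unfolding xy
      by (cases x; cases y)
        (simp_all add: pverts_tensor_product_iff \<phi> apexes af bk f_id k_id ap bq p_id q_id sideG sideH)
  qed
qed

end
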